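(* Let $\mathbf{a}=(a_1,\ldots,a_n)$ and $\mathbf{e}=(e_1,\ldots,e_n)$ be arbitrary real sequences of length $n$. The matrix $M_{\mathbf{e}\rightarrow\mathbf{a}}$ is totally non-negative if and only if $\mathbf{e}$ is a restricted growth sequence relative to $\mathbf{a}$.
   Context: For real sequences $\mathbf{a}=(a_1,\ldots,a_n)$, $\mathbf{e}=(e_1,\ldots,e_n)$, the polynomials $1, x-a_1, (x-a_1)(x-a_2),\ldots,\prod_{i=1}^n(x-a_i)$ form a basis of the real polynomials of degree at most $n$ (empty products equal $1$). $M_{\mathbf{e}\rightarrow\mathbf{a}}$ is the $(n+1)\times(n+1)$ matrix, with rows and columns indexed by $0,\ldots,n$, whose $(m,k)$ entry is the coefficient of $(x-a_1)\cdots(x-a_k)$ when $(x-e_1)\cdots(x-e_m)$ is expanded in this basis. A matrix is totally non-negative if all its minors (determinants of square submatrices) are non-negative. Restricted growth is defined by the following procedure on input $\mathbf{a},\mathbf{e}$: (1) Initialize the ordered list $X=(e_1,\ldots,e_n)$ and $i=1$. (2) While $i\le n$, locate the first element $e'$ of $X$ (in list order) with $e'\ge a_i$. (a) If no such element exists, delete the last element of $X$ and increase $i$ by $1$. (b) If $e'=a_i$, delete $e'$ from $X$ and increase $i$ by $1$. (c) If $e'>a_i$, stop and report the current value of $i$. (3) If $i=n+1$, stop and report $n+1$. The sequence $\mathbf{e}$ is a restricted growth sequence relative to $\mathbf{a}$ if this procedure terminates with the report $n+1$. *)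

theory Defs
  imports
    "HOL-Computational_Algebra.Polynomial"
    "Jordan_Normal_Form.Determinant"
    "Jordan_Normal_Form.DL_Submatrix"
begin

text \<open>A sequence \<open>a\<^sub>1, \<dots>, a\<^sub>n\<close> is a list of length \<open>n\<close>, so \<open>a\<^sub>i\<close> is \<open>a ! (i - 1)\<close>.\<close>

definition newton_poly :: "real list \<Rightarrow> nat \<Rightarrow> real poly" where
  "newton_poly a k = (\<Prod>i<k. [:- (a ! i), 1:])"

definition newton_coords :: "real list \<Rightarrow> real poly \<Rightarrow> real vec" where
  "newton_coords a p =
    (THE c. c \<in> carrier_vec (length a + 1) \<and>
            p = (\<Sum>k\<le>length a. smult (c $ k) (newton_poly a k)))"

definition change_of_basis_matrix :: "real list \<Rightarrow> real list \<Rightarrow> real mat" where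
  "change_of_basis_matrix e a =
    mat (length e + 1) (length a + 1) (\<lambda>(m, k). newton_coords a (newton_poly e m) $ k)"

definition totally_nonnegative :: "real mat \<Rightarrow> bool" where
  "totally_nonnegative A \<longleftrightarrow>
    (\<forall>I J. I \<subseteq> {..<dim_row A} \<longrightarrow> J \<subseteq> {..<dim_col A} \<longrightarrow> card I = card J \<longrightarrow>
       det (submatrix A I J) \<ge> 0)"

text \<open>
  In \<open>rg_report as i X\<close>, the list \<open>as\<close> is \<open>a\<^sub>i, \<dots>, a\<^sub>n\<close>. The element found is the first one that is
  at least \<open>c\<close>, so if it equals \<open>c\<close> then it is the first occurrence of \<open>c\<close>, which is the one that
  \<^const>\<open>remove1\<close> deletes.
\<close>

fun rg_report :: "real list \<Rightarrow> nat \<Rightarrow> real list \<Rightarrow> nat" where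
  "rg_report [] i X = i"
| "rg_report (c # as) i X =
    (case find (\<lambda>x. x \<ge> c) X of
       None \<Rightarrow> rg_report as (i + 1) (butlast X)
     | Some x \<Rightarrow> if x = c then rg_report as (i + 1) (remove1 x X) else i)"

definition restricted_growth :: "real list \<Rightarrow> real list \<Rightarrow> bool" where
  "restricted_growth a e \<longleftrightarrow> rg_report a 1 e = length a + 1"

text \<open>The description in \<^const>\<open>newton_coords\<close> is proper for every polynomial of degree at most \<open>n\<close>.\<close>

lemma degree_newton_poly: "degree (newton_poly a k) = k"
  unfolding newton_poly_def by (subst degree_prod_eq_sum_degree) auto

lemma monic_newton_poly: "coeff (newton_poly a k) k = 1"
proof -
  have "lead_coeff (newton_poly a k) = 1"
    unfolding newton_poly_def by (simp add: lead_coeff_prod)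
  then show ?thesis by (simp add: degree_newton_poly)
qed

lemma newton_expansion_exists:
  "degree p \<le> m \<Longrightarrow> \<exists>c :: nat \<Rightarrow> real. p = (\<Sum>k\<le>m. smult (c k) (newton_poly a k))"
proof (induction m arbitrary: p)
  case 0
  then obtain r where "p = [:r:]" by (auto elim: degree_eq_zeroE)
  then have "p = (\<Sum>k\<le>0. smult r (newton_poly a k))" by (simp add: newton_poly_def)
  then show ?case by (rule exI[of _ "\<lambda>_. r"])
next
  case (Suc m)
  let ?q = "p - smult (coeff p (Suc m)) (newton_poly a (Suc m))"
  have "degree ?q \<le> m"
  proof (rule degree_le, intro allI impI)
    fix i assume "m < i"
    then consider "i = Suc m" | "Suc m < i" by linarith
    then show "coeff ?q i = 0"
      by cases (use Suc.prems in \<open>auto simp: monic_newton_poly degree_newton_poly coeff_eq_0\<close>)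
  qed
  then obtain c where c: "?q = (\<Sum>k\<le>m. smult (c k) (newton_poly a k))"
    using Suc.IH by blast
  have "p = ?q + smult (coeff p (Suc m)) (newton_poly a (Suc m))" by simp
  also have "\<dots> = (\<Sum>k\<le>Suc m. smult ((c(Suc m := coeff p (Suc m))) k) (newton_poly a k))"
    unfolding c by simp
  finally show ?case by blast
qed

lemma newton_poly_independent:
  "(\<Sum>k\<le>m. smult (d k) (newton_poly a k)) = 0 \<Longrightarrow> k \<le> m \<Longrightarrow> d k = 0"
proof (induction m arbitrary: k)
  case 0
  then show ?case by (simp add: newton_poly_def)
next
  case (Suc m)
  have "coeff (\<Sum>k\<le>Suc m. smult (d k) (newton_poly a k)) (Suc m) = d (Suc m)"
    by (simp add: coeff_sum monic_newton_poly degree_newton_poly coeff_eq_0)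
  then have d: "d (Suc m) = 0" unfolding Suc.prems(1) by simp
  then show ?case using Suc by (cases "k = Suc m") auto
qed

lemma newton_coords_ex1:
  assumes "degree p \<le> length a"
  shows "\<exists>!c. c \<in> carrier_vec (length a + 1) \<and>
           p = (\<Sum>k\<le>length a. smult (c $ k) (newton_poly a k))"
proof -
  obtain c where c: "p = (\<Sum>k\<le>length a. smult (c k) (newton_poly a k))"
    using newton_expansion_exists[OF assms] by blast
  show ?thesis
  proof (rule ex1I[of _ "vec (length a + 1) c"])
    show "vec (length a + 1) c \<in> carrier_vec (length a + 1) \<and>
        p = (\<Sum>k\<le>length a. smult (vec (length a + 1) c $ k) (newton_poly a k))"
      unfolding c by (auto intro!: sum.cong)
  next
    fix b assume b: "b \<in> carrier_vec (length a + 1) \<and>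
        p = (\<Sum>k\<le>length a. smult (b $ k) (newton_poly a k))"
    have "(\<Sum>k\<le>length a. smult (b $ k - c k) (newton_poly a k)) = 0"
      using b c by (simp add: smult_diff_left sum_subtractf)
    then have "b $ k = c k" if "k \<le> length a" for k
      using newton_poly_independent[of "\<lambda>k. b $ k - c k"] that by fastforce
    then show "b = vec (length a + 1) c" using b by (intro eq_vecI) auto
  qed
qed

end

theory Submission
  imports Defs
begin

text \<open>
  Let \<open>E\<^sub>m\<close> be the polynomials of \<open>e\<close>, let \<open>e'\<close> be \<open>e\<close> after one round of the procedure for the
  first entry \<open>x\<close> of \<open>a\<close>, and let \<open>E'\<^sub>m\<close> be the polynomials of \<open>e'\<close>. Then
  \<open>E\<^sub>m\<^sub>+\<^sub>1 - t\<^sub>m E\<^sub>m = (X - x) E'\<^sub>m\<close> with \<open>t\<^sub>m \<ge> 0\<close>, so the matrix for \<open>e\<close> and \<open>a\<close> arises from the direct sum of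
  \<open>1\<close> and the matrix for \<open>e'\<close> and the tail of \<open>a\<close> by adding non-negative multiples of rows to the
  rows below them. Such row operations preserve total non-negativity. So do the inverse operations
  (Whitney): they eliminate the first column from the bottom upwards, with a positive pivot. If the
  procedure stops early, then the first column of the current matrix has a negative entry.
\<close>

section \<open>Determinants of arrays given as functions\<close>

text \<open>The array is a plain function with the size as a separate argument: replacing a row is a
  function update and selecting rows is composition, with no dimension conditions. Values outside
  the \<open>k\<close> by \<open>k\<close> block are ignored.\<close>

definition fdet :: "nat \<Rightarrow> (nat \<Rightarrow> nat \<Rightarrow> real) \<Rightarrow> real" where
  "fdet k R = det (mat k k (\<lambda>(i, j). R i j))"

lemma fdet_cong:
  assumes "\<And>i j. i < k \<Longrightarrow> j < k \<Longrightarrow> R i j = R' i j"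
  shows "fdet k R = fdet k R'"
  unfolding fdet_def by (rule arg_cong[of _ _ det]) (auto intro!: eq_matI simp: assms)

lemma fdet_0 [simp]: "fdet 0 R = 1"
  by (simp add: fdet_def)

lemma fdet_Suc_0 [simp]: "fdet (Suc 0) R = R 0 0"
  by (subst fdet_def, subst det_single) auto

text \<open>Laplace expansion. \<open>insert_index i\<close> enumerates in order the numbers other
  than \<open>i\<close>, so composing with it deletes row or column \<open>i\<close>.\<close>

lemma fdet_expand_row:
  assumes "i < Suc k"
  shows "fdet (Suc k) R =
    (\<Sum>j<Suc k. (-1) ^ (i + j) * R i j * fdet k (\<lambda>i' j'. R (insert_index i i') (insert_index j j')))"
proof -
  let ?A = "mat (Suc k) (Suc k) (\<lambda>(i, j). R i j)"
  have "mat_delete ?A i j = mat k k (\<lambda>(i', j'). R (insert_index i i') (insert_index j j'))"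
    if "j < Suc k" for j
    using that assms by (auto intro!: eq_matI simp: mat_delete_def insert_index_def)
  then show ?thesis
    unfolding fdet_def using assms
    by (subst laplace_expansion_row[of _ "Suc k" i]) (auto intro!: sum.cong simp: cofactor_def)
qed

lemma fdet_expand_col:
  assumes "j < Suc k"
  shows "fdet (Suc k) R =
    (\<Sum>i<Suc k. (-1) ^ (i + j) * R i j * fdet k (\<lambda>i' j'. R (insert_index i i') (insert_index j j')))"
proof -
  let ?A = "mat (Suc k) (Suc k) (\<lambda>(i, j). R i j)"
  have "mat_delete ?A i j = mat k k (\<lambda>(i', j'). R (insert_index i i') (insert_index j j'))"
    if "i < Suc k" for i
    using that assms by (auto intro!: eq_matI simp: mat_delete_def insert_index_def)
  then show ?thesis
    unfolding fdet_def using assms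
    by (subst laplace_expansion_column[of _ "Suc k" j]) (auto intro!: sum.cong simp: cofactor_def)
qed

lemma fdet_equal_rows:
  assumes "p < k" "q < k" "p \<noteq> q" "\<And>j. j < k \<Longrightarrow> R p j = R q j"
  shows "fdet k R = 0"
  unfolding fdet_def
  by (rule det_identical_rows[of _ k p q]) (use assms in \<open>auto intro!: eq_vecI\<close>)

lemma fdet_equal_cols:
  assumes "p < k" "q < k" "p \<noteq> q" "\<And>i. i < k \<Longrightarrow> R i p = R i q"
  shows "fdet k R = 0"
  unfolding fdet_def
  by (rule det_identical_columns[of _ k p q]) (use assms in \<open>auto intro!: eq_vecI\<close>)

lemma fdet_zero_row:
  assumes "p < k" "\<And>j. j < k \<Longrightarrow> R p j = 0"
  shows "fdet k R = 0"
proof -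
  obtain k' where "k = Suc k'" using assms(1) by (cases k) auto
  then show ?thesis using fdet_expand_row[of p k' R] assms by simp
qed

lemma fdet_zero_col:
  assumes "q < k" "\<And>i. i < k \<Longrightarrow> R i q = 0"
  shows "fdet k R = 0"
proof -
  obtain k' where "k = Suc k'" using assms(1) by (cases k) auto
  then show ?thesis using fdet_expand_col[of q k' R] assms by simp
qed

lemma insert_index_neq: "insert_index i j \<noteq> i"
  by (simp add: insert_index_def)

text \<open>The cofactors of row \<open>q\<close> do not involve row \<open>q\<close>, so one
  coefficient vector serves all replacements \<open>u\<close>.\<close>

lemma fdet_row_as_sum:
  assumes "q < k"
  shows "\<exists>h. \<forall>u. fdet k (R(q := u)) = (\<Sum>j<k. u j * h j)"
proof -
  obtain k' where k: "k = Suc k'" using assms by (cases k) auto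
  let ?h = "\<lambda>j. (-1) ^ (q + j) * fdet k' (\<lambda>i' j'. R (insert_index q i') (insert_index j j'))"
  have "fdet k (R(q := u)) = (\<Sum>j<k. u j * ?h j)" for u
    using assms unfolding k
    by (subst fdet_expand_row[of q]) (auto intro!: sum.cong simp: insert_index_neq)
  then show ?thesis by (intro exI[of _ ?h]) blast
qed

lemma fdet_row_linear:
  assumes "q < k"
  shows "fdet k (R(q := (\<lambda>j. s * u j + t * v j))) = s * fdet k (R(q := u)) + t * fdet k (R(q := v))"
proof -
  obtain h where "\<And>u. fdet k (R(q := u)) = (\<Sum>j<k. u j * h j)"
    using fdet_row_as_sum[OF assms] by blast
  then show ?thesis
    by (simp add: sum.distrib sum_distrib_left algebra_simps)
qed

section \<open>A three-term relation between minors\<close>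

text \<open>Putting a second copy of column \<open>t\<close> in front of the \<open>k + 1\<close>
  rows of length \<open>k\<close> gives a singular square array; this is its expansion along the new
  column.\<close>

lemma row_dependence:
  assumes "t < k"
  shows "(\<Sum>i<Suc k. (-1) ^ i * R i t * fdet k (\<lambda>i'. R (insert_index i i'))) = 0"
proof -
  let ?R = "\<lambda>i j. case j of 0 \<Rightarrow> R i t | Suc j' \<Rightarrow> R i j'"
  have "fdet (Suc k) ?R = 0"
    by (rule fdet_equal_cols[of 0 _ "Suc t"]) (use assms in auto)
  then show ?thesis
    by (subst (asm) fdet_expand_col[of 0]) (simp_all add: insert_index_def)
qed

text \<open>A three-term Pluecker relation. \<open>G i\<close> omits row \<open>i\<close> from
  \<open>k + 2\<close> rows of length \<open>k + 1\<close>; \<open>H u\<close> puts \<open>u\<close>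
  in place of the rows \<open>q\<close>, \<open>q + 1\<close>, \<open>q + 2\<close> and omits column
  \<open>b\<close>. Applying the linear form \<open>H\<close> to the row dependence with
  coefficients \<open>G\<close> leaves three terms, because \<open>H\<close> vanishes on every row
  that it already contains.\<close>

lemma three_term_relation:
  fixes R :: "nat \<Rightarrow> nat \<Rightarrow> real" and k q b :: nat
  defines "G \<equiv> \<lambda>i. fdet (Suc k) (\<lambda>i'. R (insert_index i i'))"
    and "H \<equiv> \<lambda>u. fdet k (\<lambda>i' j'. (if i' < q then R i' else if i' = q then u else R (i' + 2)) (insert_index b j'))"
  assumes "q < k" "b < Suc k"
  shows "G (Suc q) * H (R (Suc q)) = G q * H (R q) + G (q + 2) * H (R (q + 2))"
proof -
  let ?T = "\<lambda>i' j'. (if i' < q then R i' else R (i' + 2)) (insert_index b j')"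
  obtain h where h: "\<And>u. fdet k (?T(q := u)) = (\<Sum>j<k. u j * h j)"
    using fdet_row_as_sum[OF assms(3), of ?T] by blast
  have H: "H u = (\<Sum>j<k. u (insert_index b j) * h j)" for u
    unfolding h[symmetric] H_def by (rule fdet_cong) auto
  have "(\<Sum>i<Suc (Suc k). (-1) ^ i * G i * H (R i)) =
      (\<Sum>i<Suc (Suc k). \<Sum>j<k. h j * ((-1) ^ i * R i (insert_index b j) * G i))"
    unfolding H sum_distrib_left by (intro sum.cong refl) (simp add: algebra_simps)
  also have "\<dots> = (\<Sum>j<k. h j * (\<Sum>i<Suc (Suc k). (-1) ^ i * R i (insert_index b j) * G i))"
    unfolding sum_distrib_left by (rule sum.swap)
  also have "\<dots> = 0"
    unfolding G_def
    by (intro sum.neutral ballI, subst row_dependence) (auto simp: insert_index_def)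
  finally have "0 = (\<Sum>i<Suc (Suc k). (-1) ^ i * G i * H (R i))" by simp
  also have "\<dots> = (\<Sum>i\<in>{q, Suc q, q + 2}. (-1) ^ i * G i * H (R i))"
  proof (rule sum.mono_neutral_right)
    show "{q, Suc q, q + 2} \<subseteq> {..<Suc (Suc k)}" using assms by auto
    show "\<forall>i\<in>{..<Suc (Suc k)} - {q, Suc q, q + 2}. (-1) ^ i * G i * H (R i) = 0"
    proof
      fix i assume i: "i \<in> {..<Suc (Suc k)} - {q, Suc q, q + 2}"
      have "H (R i) = 0"
      proof (cases "i < q")
        case True
        then show ?thesis unfolding H_def
          by (intro fdet_equal_rows[of i _ q]) (use assms i in auto)
      next
        case False
        then have "i - 2 + 2 = i" "q < i - 2" "i - 2 < k" using i by auto
        then show ?thesis unfolding H_def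
          by (intro fdet_equal_rows[of "i - 2" _ q]) (use assms(3) in auto)
      qed
      then show "(-1) ^ i * G i * H (R i) = 0" by simp
    qed
  qed simp
  also have "\<dots> = (-1) ^ q * (G q * H (R q) - G (Suc q) * H (R (Suc q)) + G (q + 2) * H (R (q + 2)))"
    by (simp add: algebra_simps)
  finally show ?thesis by simp
qed

section \<open>Minors and total non-negativity\<close>

text \<open>An index set of size \<open>k\<close> is represented by its increasing enumeration, of
  which only the values below \<open>k\<close> matter. Exchanging one index is then a function
  update.\<close>

definition increasing :: "nat \<Rightarrow> nat \<Rightarrow> (nat \<Rightarrow> nat) \<Rightarrow> bool" where
  "increasing k N r \<longleftrightarrow> (\<forall>i<k. r i < N) \<and> (\<forall>i j. i < j \<longrightarrow> j < k \<longrightarrow> r i < r j)"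

definition minor :: "(nat \<Rightarrow> nat \<Rightarrow> real) \<Rightarrow> nat \<Rightarrow> (nat \<Rightarrow> nat) \<Rightarrow> (nat \<Rightarrow> nat) \<Rightarrow> real" where
  "minor A k r c = fdet k (\<lambda>i j. A (r i) (c j))"

definition tnn :: "nat \<Rightarrow> nat \<Rightarrow> (nat \<Rightarrow> nat \<Rightarrow> real) \<Rightarrow> bool" where
  "tnn N M A \<longleftrightarrow> (\<forall>k r c. increasing k N r \<longrightarrow> increasing k M c \<longrightarrow> minor A k r c \<ge> 0)"

lemma tnnD: "tnn N M A \<Longrightarrow> increasing k N r \<Longrightarrow> increasing k M c \<Longrightarrow> minor A k r c \<ge> 0"
  by (simp add: tnn_def)

lemma tnn_cong:
  assumes "\<And>i j. i < N \<Longrightarrow> j < M \<Longrightarrow> A i j = B i j"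
  shows "tnn N M A \<longleftrightarrow> tnn N M B"
proof -
  have "minor A k r c = minor B k r c" if "increasing k N r" "increasing k M c" for k r c
    unfolding minor_def by (rule fdet_cong) (use that assms in \<open>auto simp: increasing_def\<close>)
  then show ?thesis by (auto simp: tnn_def)
qed

lemma increasing_insert_index:
  "increasing (Suc k) N r \<Longrightarrow> b < Suc k \<Longrightarrow> increasing k N (\<lambda>i. r (insert_index b i))"
  by (auto simp: increasing_def insert_index_def)

lemma increasing_update_pred:
  assumes "increasing k N r" "q < k" "r q = Suc m" "\<And>i. i < q \<Longrightarrow> r i < m"
  shows "increasing k N (r(q := m))"
  unfolding increasing_def
proof (intro conjI allI impI)
  fix i j assume ij: "i < j" "j < k"
  have "r i < r j" using assms(1) ij by (simp add: increasing_def)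
  then show "(r(q := m)) i < (r(q := m)) j" using assms ij by auto
next
  fix i assume "i < k"
  moreover have "Suc m < N" using assms(1-3) unfolding increasing_def by metis
  ultimately show "(r(q := m)) i < N" using assms(1) by (auto simp: increasing_def)
qed

section \<open>Operations on adjacent rows\<close>

text \<open>Strict monotonicity lets row \<open>p\<close> occur at position \<open>q\<close> only,
  so linearity of the determinant in that row applies.\<close>

lemma minor_row_update:
  assumes "increasing k N r" "q < k" "r q = p"
  shows "minor (A(p := (\<lambda>j. s * A p j + t * A p' j))) k r c =
    s * minor A k r c + t * minor A k (r(q := p')) c"
proof -
  have ne: "r i \<noteq> p" if "i < k" "i \<noteq> q" for i
    using assms that unfolding increasing_def by (metis nat_neq_iff)
  let ?R = "\<lambda>i j. A (r i) (c j)"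
  have "minor (A(p := (\<lambda>j. s * A p j + t * A p' j))) k r c =
      fdet k (?R(q := (\<lambda>j. s * A p (c j) + t * A p' (c j))))"
    unfolding minor_def by (rule fdet_cong) (use ne assms in auto)
  also have "\<dots> = s * fdet k (?R(q := (\<lambda>j. A p (c j)))) + t * fdet k (?R(q := (\<lambda>j. A p' (c j))))"
    by (rule fdet_row_linear[OF assms(2)])
  also have "fdet k (?R(q := (\<lambda>j. A p (c j)))) = minor A k r c"
    unfolding minor_def by (rule fdet_cong) (use assms in auto)
  also have "fdet k (?R(q := (\<lambda>j. A p' (c j)))) = minor A k (r(q := p')) c"
    unfolding minor_def by (rule fdet_cong) (use assms in auto)
  finally show ?thesis .
qed

lemma minor_row_update_notin:
  assumes "\<And>i. i < k \<Longrightarrow> r i \<noteq> p"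
  shows "minor (A(p := u)) k r c = minor A k r c"
  unfolding minor_def by (rule fdet_cong) (use assms in auto)

lemma minor_equal_rows:
  assumes "p < k" "q < k" "p \<noteq> q" "r p = r q"
  shows "minor A k r c = 0"
  unfolding minor_def by (rule fdet_equal_rows[of p _ q]) (use assms in auto)

text \<open>A minor through row \<open>Suc m\<close> either contains row \<open>m\<close> as well, and then does not change, or
  replacing row \<open>Suc m\<close> by row \<open>m\<close> keeps the rows in order.\<close>

lemma tnn_row_op:
  assumes "\<And>k r c q. \<lbrakk>increasing k N r; increasing k M c; q < k; r q = Suc m; \<And>i. i < q \<Longrightarrow> r i < m\<rbrakk>
      \<Longrightarrow> minor A k r c + t * minor A k (r(q := m)) c \<ge> 0"
    and "tnn N M A"
  shows "tnn N M (A(Suc m := (\<lambda>j. A (Suc m) j + t * A m j)))"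
  unfolding tnn_def
proof (intro allI impI)
  fix k r c assume r: "increasing k N r" and c: "increasing k M c"
  have upd: "minor (A(Suc m := (\<lambda>j. A (Suc m) j + t * A m j))) k r c =
      minor A k r c + t * minor A k (r(q := m)) c" if "q < k" "r q = Suc m" for q
    using minor_row_update[OF r that, of A 1 t m c] by simp
  consider "\<forall>i<k. r i \<noteq> Suc m" | q p where "q < k" "r q = Suc m" "p < k" "r p = m"
    | q where "q < k" "r q = Suc m" "\<forall>i<k. r i \<noteq> m"
    by blast
  then show "minor (A(Suc m := (\<lambda>j. A (Suc m) j + t * A m j))) k r c \<ge> 0"
  proof cases
    case 1
    then show ?thesis using tnnD[OF assms(2) r c] by (simp add: minor_row_update_notin)
  next
    case 2
    then have "minor A k (r(q := m)) c = 0"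
      by (intro minor_equal_rows[of p _ q]) auto
    then show ?thesis using tnnD[OF assms(2) r c] upd[OF 2(1,2)] by simp
  next
    case 3
    have "r i < m" if "i < q" for i
    proof -
      have "r i < Suc m" using r that 3 unfolding increasing_def by metis
      moreover have "r i \<noteq> m" using 3 that by simp
      ultimately show ?thesis by simp
    qed
    then show ?thesis using assms(1)[OF r c 3(1,2)] upd[OF 3(1,2)] by simp
  qed
qed

text \<open>Both minors in the condition of \<open>tnn_row_op\<close> have their rows in order,
  hence are non-negative, and so is \<open>t\<close>.\<close>

lemma tnn_add_previous_row:
  assumes "tnn N M A" "t \<ge> 0"
  shows "tnn N M (A(Suc m := (\<lambda>j. A (Suc m) j + t * A m j)))"
proof (rule tnn_row_op[OF _ assms(1)])
  fix k r c q
  assume h: "increasing k N r" "increasing k M c" "q < k" "r q = Suc m" "\<And>i. i < q \<Longrightarrow> r i < m"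
  show "minor A k r c + t * minor A k (r(q := m)) c \<ge> 0"
    using tnnD[OF assms(1) h(1,2)] tnnD[OF assms(1) increasing_update_pred[OF h(1,3-5)] h(2)] assms(2)
    by simp
qed

text \<open>Induction on the number of rows above row \<open>m\<close>. The three-term relation bounds the quotient of
  the two minors from below by the quotient of two smaller minors, unless all the denominators
  vanish; but then the left-hand side vanishes too, by Laplace expansion.\<close>

lemma elimination_minor_inequality:
  assumes "tnn N M A" "0 < M" "A m 0 > 0" "\<And>i. Suc m < i \<Longrightarrow> i < N \<Longrightarrow> A i 0 = 0"
    and "increasing k N r" "increasing k M c" "q < k" "r q = Suc m" "\<And>i. i < q \<Longrightarrow> r i < m"
  shows "A (Suc m) 0 * minor A k (r(q := m)) c \<le> A m 0 * minor A k r c"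
  using assms(5-)
proof (induction q arbitrary: k r c)
  case 0
  \<comment> \<open>Row \<open>m\<close> and column \<open>0\<close> are put in front. Below row
    \<open>Suc m\<close> column \<open>0\<close> is zero, so expansion along it leaves two terms,
    whose sum is the difference of the two sides of the claim.\<close>
  let ?r = "\<lambda>i. case i of 0 \<Rightarrow> m | Suc i' \<Rightarrow> r i'"
  let ?c = "\<lambda>j. case j of 0 \<Rightarrow> 0 | Suc j' \<Rightarrow> c j'"
  have rgt: "r 0 < r i" if "0 < i" "i < k" for i
    using 0(1) that unfolding increasing_def by blast
  have "minor A (Suc k) ?r ?c =
      (\<Sum>i<Suc k. (-1) ^ i * A (?r i) 0 * fdet k (\<lambda>i' j'. A (?r (insert_index i i')) (c j')))"
    unfolding minor_def by (subst fdet_expand_col[of 0]) (simp_all add: insert_index_def)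
  also have "\<dots> = (\<Sum>i\<in>{0, 1}. (-1) ^ i * A (?r i) 0 * fdet k (\<lambda>i' j'. A (?r (insert_index i i')) (c j')))"
  proof (rule sum.mono_neutral_right)
    show "{0, 1} \<subseteq> {..<Suc k}" using 0 by auto
    show "\<forall>i\<in>{..<Suc k} - {0, 1}. (-1) ^ i * A (?r i) 0 * fdet k (\<lambda>i' j'. A (?r (insert_index i i')) (c j')) = 0"
    proof
      fix i assume i: "i \<in> {..<Suc k} - {0, 1}"
      then obtain i' where i': "i = Suc i'" "0 < i'" "i' < k" by (cases i) auto
      then have "A (?r i) 0 = 0"
        using assms(4)[of "r i'"] rgt[of i'] 0 by (auto simp: increasing_def)
      then show "(-1) ^ i * A (?r i) 0 * fdet k (\<lambda>i' j'. A (?r (insert_index i i')) (c j')) = 0"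
        by simp
    qed
  qed simp
  also have "\<dots> = A m 0 * minor A k r c - A (Suc m) 0 * minor A k (r(0 := m)) c"
  proof -
    have "fdet k (\<lambda>i' j'. A (?r (insert_index 1 i')) (c j')) = minor A k (r(0 := m)) c"
      unfolding minor_def by (rule fdet_cong) (auto simp: insert_index_def split: nat.split)
    moreover have "fdet k (\<lambda>i' j'. A (?r (insert_index 0 i')) (c j')) = minor A k r c"
      unfolding minor_def by (rule fdet_cong) (auto simp: insert_index_def)
    ultimately show ?thesis using 0 by simp
  qed
  finally have eq: "minor A (Suc k) ?r ?c = A m 0 * minor A k r c - A (Suc m) 0 * minor A k (r(0 := m)) c" .
  have "minor A (Suc k) ?r ?c \<ge> 0"
  \<comment> \<open>If \<open>c\<close> already contains column \<open>0\<close>, the enlarged minor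
    has a repeated column; otherwise \<open>?c\<close> is increasing.\<close>
  proof (cases "c 0 = 0")
    case True
    have "minor A (Suc k) ?r ?c = 0" unfolding minor_def
      by (rule fdet_equal_cols[of 0 _ 1]) (use 0 True in auto)
    then show ?thesis by simp
  next
    case False
    have "0 < c j" if "j < k" for j
      using 0(2) False that unfolding increasing_def by (metis gr_zeroI less_nat_zero_code)
    then have "increasing (Suc k) M ?c"
      using 0(2) assms(2) unfolding increasing_def by (auto split: nat.split)
    moreover have "m < r i" if "i < k" for i
      using rgt[of i] that 0(4) by (cases "i = 0") auto
    then have "increasing (Suc k) N ?r"
      using 0 unfolding increasing_def by (auto split: nat.split)
    ultimately show ?thesis using assms(1) by (auto intro: tnnD)
  qed
  then show ?case using eq by linarith
next
  case (Suc p)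
  obtain l where k: "k = Suc l" and pl: "p < l" using Suc.prems(3) by (cases k) auto
  \<comment> \<open>Inserting \<open>m\<close> into \<open>r\<close> gives \<open>\<rho>\<close>,
    and dropping \<open>r p\<close> from \<open>r\<close> gives \<open>s\<close>. Positions
    \<open>p\<close>, \<open>p + 1\<close>, \<open>p + 2\<close> of \<open>\<rho>\<close> carry
    \<open>r p\<close>, \<open>m\<close>, \<open>Suc m\<close>, the rows singled out by the
    three-term relation.\<close>
  define \<rho> where "\<rho> i = (if i \<le> p then r i else if i = Suc p then m else r (i - 1))" for i
  define s where "s i = (if i < p then r i else if i = p then Suc m else r (Suc i))" for i
  have inc: "r i < r j" if "i < j" "j < k" for i j
    using Suc.prems(1) that by (auto simp: increasing_def)
  have bd: "r i < N" if "i < k" for i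
    using Suc.prems(1) that by (auto simp: increasing_def)
  have rlow: "r i < m" if "i \<le> p" for i using Suc.prems(5)[of i] that by simp
  have mN: "Suc m < N" using bd[of "Suc p"] Suc.prems by simp
  have inc_rho: "increasing (Suc k) N \<rho>"
    unfolding increasing_def
  proof (intro conjI allI impI)
    fix i assume "i < Suc k" then show "\<rho> i < N"
      using bd mN Suc.prems(3) by (auto simp: \<rho>_def)
  next
    fix i j assume ij: "i < j" "j < Suc k"
    have up: "m < r i'" if "p < i'" "i' < k" for i'
      using inc[of "Suc p" i'] that Suc.prems(4) by (cases "i' = Suc p") auto
    consider "j \<le> p" | "j = Suc p" | "i \<le> p" "Suc p < j" | "i = Suc p" "Suc p < j" | "Suc p < i"
      using ij by linarith
    then show "\<rho> i < \<rho> j"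
    proof cases
      case 1
      then show ?thesis using ij inc[of i j] Suc.prems(3) by (simp add: \<rho>_def)
    next
      case 2
      then show ?thesis using ij rlow[of i] by (simp add: \<rho>_def)
    next
      case 3
      then have "r i < m" "m < r (j - 1)" using ij rlow[of i] up[of "j - 1"] by auto
      then show ?thesis using 3 by (simp add: \<rho>_def)
    next
      case 4
      then show ?thesis using ij up[of "j - 1"] by (simp add: \<rho>_def)
    next
      case 5
      then show ?thesis using ij inc[of "i - 1" "j - 1"] by (simp add: \<rho>_def)
    qed
  qed
  have inc_s: "increasing l N s"
    unfolding increasing_def
  proof (intro conjI allI impI)
    fix i assume "i < l" then show "s i < N"
      using bd mN k by (auto simp: s_def)
  next
    fix i j assume ij: "i < j" "j < l"
    show "s i < s j" using ij rlow[of i] inc[of i j] inc[of i "Suc j"] inc[of "Suc i" "Suc j"] Suc.prems(4) k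
      by (auto simp: s_def)
  qed
  have rho_ge: "minor A k (\<lambda>i. \<rho> (insert_index b i)) c \<ge> 0" if "b < Suc k" for b
    by (rule tnnD[OF assms(1) increasing_insert_index[OF inc_rho that] Suc.prems(2)])
  have rho1: "minor A k (\<lambda>i. \<rho> (insert_index (Suc p) i)) c = minor A k r c"
    unfolding minor_def by (rule fdet_cong) (auto simp: \<rho>_def insert_index_def)
  have rho2: "minor A k (\<lambda>i. \<rho> (insert_index (Suc (Suc p)) i)) c = minor A k (r(Suc p := m)) c"
    unfolding minor_def by (rule fdet_cong) (auto simp: \<rho>_def insert_index_def)
  have r_ge: "minor A k r c \<ge> 0" by (rule tnnD[OF assms(1) Suc.prems(1,2)])
  have rm_inc: "increasing k N (r(Suc p := m))"
    by (rule increasing_update_pred) (use Suc.prems in auto)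
  have rm_ge: "minor A k (r(Suc p := m)) c \<ge> 0" by (rule tnnD[OF assms(1) rm_inc Suc.prems(2)])
  \<comment> \<open>The denominators are read in two ways: as a replacement in \<open>s\<close>, for
    the three-term relation and the induction hypothesis, and as \<open>r(Suc p := m)\<close>
    without position \<open>p\<close>, for non-negativity and the Laplace expansion.\<close>
  have sm: "minor A l (s(p := m)) c' = minor A l (\<lambda>i. (r(Suc p := m)) (insert_index p i)) c'" for c'
    unfolding minor_def by (rule fdet_cong) (auto simp: s_def insert_index_def)
  have sm_ge: "minor A l (s(p := m)) (\<lambda>j. c (insert_index b j)) \<ge> 0" if "b < k" for b
  proof -
    have "increasing l N (\<lambda>i. (r(Suc p := m)) (insert_index p i))"
      using rm_inc unfolding k by (rule increasing_insert_index) (use pl in simp)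
    moreover have "increasing l M (\<lambda>j. c (insert_index b j))"
      using Suc.prems(2) that unfolding k by (rule increasing_insert_index)
    ultimately show ?thesis unfolding sm by (rule tnnD[OF assms(1)])
  qed
  show ?case
  proof (cases "\<exists>b<k. minor A l (s(p := m)) (\<lambda>j. c (insert_index b j)) \<noteq> 0")
    case True
    then obtain b where b: "b < k" and pos: "minor A l (s(p := m)) (\<lambda>j. c (insert_index b j)) > 0"
      using sm_ge by force
    let ?c = "\<lambda>j. c (insert_index b j)"
    have inc_c: "increasing l M ?c"
      using Suc.prems(2) b unfolding k by (rule increasing_insert_index)
    have IH: "A (Suc m) 0 * minor A l (s(p := m)) ?c \<le> A m 0 * minor A l s ?c"
      by (rule Suc.IH[OF inc_s inc_c pl]) (auto simp: s_def rlow)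
    have sx: "minor A l (s(p := r p)) ?c \<ge> 0"
    proof -
      have "minor A l (s(p := r p)) ?c = minor A l (\<lambda>i. r (insert_index (Suc p) i)) ?c"
        unfolding minor_def by (rule fdet_cong) (auto simp: s_def insert_index_def)
      moreover have "increasing l N (\<lambda>i. r (insert_index (Suc p) i))"
        using Suc.prems(1,3) unfolding k by (rule increasing_insert_index)
      ultimately show ?thesis using tnnD[OF assms(1) _ inc_c] by simp
    qed
    have H: "fdet l (\<lambda>i' j'. (if i' < p then \<lambda>j. A (\<rho> i') (c j) else if i' = p then (\<lambda>j. A w (c j)) else
          (\<lambda>j. A (\<rho> (i' + 2)) (c j))) (insert_index b j')) = minor A l (s(p := w)) ?c" for w
      unfolding minor_def by (rule fdet_cong) (auto simp: s_def \<rho>_def)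
    have G: "fdet k (\<lambda>i' j. A (\<rho> (insert_index w i')) (c j)) =
        minor A k (\<lambda>i. \<rho> (insert_index w i)) c" for w
      by (simp add: minor_def)
    \<comment> \<open>Deleting \<open>m\<close> from \<open>\<rho>\<close> leaves \<open>r\<close>,
      and deleting \<open>Suc m\<close> leaves \<open>r(Suc p := m)\<close>. The first product on
      the right is non-negative, which turns this identity into an inequality.\<close>
    have "minor A k r c * minor A l (s(p := m)) ?c =
        minor A k (\<lambda>i. \<rho> (insert_index p i)) c * minor A l (s(p := r p)) ?c +
        minor A k (r(Suc p := m)) c * minor A l s ?c"
    proof -
      have ww: "\<rho> p = r p" "\<rho> (Suc p) = m" "\<rho> (p + 2) = Suc m" "s(p := Suc m) = s"
        using Suc.prems(4) by (auto simp: \<rho>_def s_def)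
      show ?thesis
        using three_term_relation[OF pl, of b "\<lambda>i j. A (\<rho> i) (c j)"] b
        unfolding H ww k[symmetric] G using rho1 rho2 by simp
    qed
    moreover have "minor A k (\<lambda>i. \<rho> (insert_index p i)) c * minor A l (s(p := r p)) ?c \<ge> 0"
      using rho_ge[of p] sx Suc.prems(3) by simp
    ultimately have "minor A k (r(Suc p := m)) c * minor A l s ?c \<le> minor A k r c * minor A l (s(p := m)) ?c"
      by linarith
    then have "A m 0 * (minor A k (r(Suc p := m)) c * minor A l s ?c) \<le>
        A m 0 * (minor A k r c * minor A l (s(p := m)) ?c)"
      using assms(3) by simp
    moreover have "minor A k (r(Suc p := m)) c * (A (Suc m) 0 * minor A l (s(p := m)) ?c) \<le>
        minor A k (r(Suc p := m)) c * (A m 0 * minor A l s ?c)"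
      by (rule mult_left_mono[OF IH rm_ge])
    ultimately have "(A (Suc m) 0 * minor A k (r(Suc p := m)) c) * minor A l (s(p := m)) ?c \<le>
        (A m 0 * minor A k r c) * minor A l (s(p := m)) ?c"
      by (simp add: algebra_simps)
    then show ?thesis using pos by (rule mult_right_le_imp_le)
  next
    case False
    have "minor A k (r(Suc p := m)) c = (\<Sum>j<Suc l. (-1) ^ (p + j) * A ((r(Suc p := m)) p) (c j) *
        minor A l (s(p := m)) (\<lambda>j'. c (insert_index j j')))"
      unfolding sm using pl unfolding k minor_def by (subst fdet_expand_row[of p]) auto
    also have "\<dots> = 0" using False k by simp
    finally have zero: "minor A k (r(Suc p := m)) c = 0" .
    show ?thesis unfolding zero using r_ge assms(3) by simp
  qed
qed

text \<open>Divided by the pivot \<open>A m 0\<close>, the inequality for minors becomes the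
  condition of \<open>tnn_row_op\<close> for a multiplier that clears the entry of row
  \<open>Suc m\<close> in column \<open>0\<close>.\<close>

lemma tnn_eliminate_row:
  assumes "tnn N M A" "0 < M" "A m 0 > 0" "\<And>i. Suc m < i \<Longrightarrow> i < N \<Longrightarrow> A i 0 = 0"
  shows "tnn N M (A(Suc m := (\<lambda>j. A (Suc m) j - A (Suc m) 0 / A m 0 * A m j)))"
proof -
  have "tnn N M (A(Suc m := (\<lambda>j. A (Suc m) j + (- (A (Suc m) 0 / A m 0)) * A m j)))"
  proof (rule tnn_row_op[OF _ assms(1)])
    fix k r c q
    assume h: "increasing k N r" "increasing k M c" "q < k" "r q = Suc m" "\<And>i. i < q \<Longrightarrow> r i < m"
    show "minor A k r c + - (A (Suc m) 0 / A m 0) * minor A k (r(q := m)) c \<ge> 0"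
      using elimination_minor_inequality[OF assms h] assms(3) by (simp add: field_simps)
  qed
  then show ?thesis by simp
qed

section \<open>Direct sums with one and chains of row operations\<close>

text \<open>A minor that uses just one of row \<open>0\<close> and column \<open>0\<close> has a
  zero row or column. One that uses both equals the minor without them, and one that uses neither
  lies in the lower block.\<close>

lemma tnn_direct_sum_one:
  assumes "\<And>j. R 0 j = (if j = 0 then 1 else 0)" "\<And>i. i < N \<Longrightarrow> R (Suc i) 0 = 0"
  shows "tnn (Suc N) (Suc M) R \<longleftrightarrow> tnn N M (\<lambda>i j. R (Suc i) (Suc j))"
proof
  assume R: "tnn (Suc N) (Suc M) R"
  show "tnn N M (\<lambda>i j. R (Suc i) (Suc j))"
    unfolding tnn_def
  proof (intro allI impI)
    fix k r c assume "increasing k N r" "increasing k M c"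
    then have "increasing k (Suc N) (\<lambda>i. Suc (r i))" "increasing k (Suc M) (\<lambda>i. Suc (c i))"
      by (auto simp: increasing_def)
    from tnnD[OF R this] show "minor (\<lambda>i j. R (Suc i) (Suc j)) k r c \<ge> 0"
      by (simp add: minor_def)
  qed
next
  assume S: "tnn N M (\<lambda>i j. R (Suc i) (Suc j))"
  have pred: "increasing k K (\<lambda>i. r i - 1) \<and> (\<forall>i<k. r i = Suc (r i - 1))"
    if r: "increasing k (Suc K) r" and nz: "\<And>i. i < k \<Longrightarrow> r i \<noteq> 0" for k K r
  proof -
    have "r i - 1 < r j - 1" if "i < j" "j < k" for i j
    proof -
      have "r i < r j" using r that unfolding increasing_def by blast
      then show ?thesis using nz[of i] that by simp
    qed
    moreover have "r i - 1 < K" if "i < k" for i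
    proof -
      have "r i < Suc K" using r that unfolding increasing_def by blast
      then show ?thesis using nz[OF that] by simp
    qed
    ultimately show ?thesis using nz by (auto simp: increasing_def)
  qed
  have shifted: "minor R k r c \<ge> 0" if "increasing k (Suc N) r" "increasing k (Suc M) c"
    "\<And>i. i < k \<Longrightarrow> r i \<noteq> 0" "\<And>i. i < k \<Longrightarrow> c i \<noteq> 0" for k r c
  proof -
    note r = pred[OF that(1,3)] and c = pred[OF that(2,4)]
    have "minor R k r c = minor (\<lambda>i j. R (Suc i) (Suc j)) k (\<lambda>i. r i - 1) (\<lambda>i. c i - 1)"
      unfolding minor_def by (rule fdet_cong) (use r c in auto)
    then show ?thesis using tnnD[OF S] r c by simp
  qed
  show "tnn (Suc N) (Suc M) R"
    unfolding tnn_def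
  proof (intro allI impI)
    fix k r c assume r: "increasing k (Suc N) r" and c: "increasing k (Suc M) c"
    have nz: "f i \<noteq> 0" if "increasing k K f" "i < k" "f 0 \<noteq> 0 \<or> 0 < i" for f i K
      using that unfolding increasing_def by (metis gr_zeroI less_nat_zero_code)
    consider "k = 0" | "0 < k" "r 0 = 0" "c 0 \<noteq> 0" | "0 < k" "r 0 \<noteq> 0" "c 0 = 0"
      | "0 < k" "r 0 = 0" "c 0 = 0" | "r 0 \<noteq> 0" "c 0 \<noteq> 0"
      by blast
    then show "minor R k r c \<ge> 0"
    proof cases
      case 1
      then show ?thesis by (simp add: minor_def)
    next
      case 2
      then have "c j \<noteq> 0" if "j < k" for j using nz[OF c that] by simp
      then have "minor R k r c = 0" unfolding minor_def
        by (intro fdet_zero_row[of 0]) (use 2 assms(1) in auto)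
      then show ?thesis by simp
    next
      case 3
      have "R (r i) (c 0) = 0" if "i < k" for i
      proof -
        have "r i \<noteq> 0" "r i < Suc N" using nz[OF r that] 3 r that by (auto simp: increasing_def)
        then show ?thesis using assms(2)[of "r i - 1"] 3 by simp
      qed
      then have "minor R k r c = 0" unfolding minor_def
        by (intro fdet_zero_col[of 0]) (use 3 in auto)
      then show ?thesis by simp
    next
      case 4
      obtain k' where k: "k = Suc k'" using 4(1) by (cases k) auto
      have pos: "r (Suc i) \<noteq> 0" "c (Suc i) \<noteq> 0" if "i < k'" for i
        using nz[OF r, of "Suc i"] nz[OF c, of "Suc i"] that k by simp_all
      have "c i \<noteq> 0" if "i < k" "i \<noteq> 0" for i using nz[OF c] that by blast
      then have "R 0 (c i) = 0" if "i < k" "i \<noteq> 0" for i using assms(1) that by simp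
      note zero = this
      have "minor R k r c =
          (\<Sum>j<Suc k'. (-1) ^ j * R 0 (c j) * fdet k' (\<lambda>i' j'. R (r (Suc i')) (c (insert_index j j'))))"
        unfolding minor_def k
        by (subst fdet_expand_row[of 0]) (simp_all add: 4 insert_index_def)
      also have "\<dots> = (\<Sum>j\<in>{0}. (-1) ^ j * R 0 (c j) * fdet k' (\<lambda>i' j'. R (r (Suc i')) (c (insert_index j j'))))"
        by (rule sum.mono_neutral_right) (use zero k in auto)
      also have "\<dots> = minor R k' (\<lambda>i. r (Suc i)) (\<lambda>j. c (Suc j))"
        by (simp add: 4 assms(1) minor_def insert_index_def)
      also have "\<dots> \<ge> 0"
        by (rule shifted) (use r c pos k in \<open>auto simp: increasing_def\<close>)
      finally show ?thesis .
    next
      case 5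
      show ?thesis by (rule shifted[OF r c]) (use 5 nz[OF r] nz[OF c] in blast)+
    qed
  qed
qed

text \<open>Rows are exchanged one at a time. From \<open>R\<close> to \<open>E\<close>, working
  downwards, a multiple of the restored row above is added. From \<open>E\<close> to
  \<open>R\<close>, working upwards, the first entry of a row is eliminated, with the row above as
  pivot row.\<close>

lemma tnn_row_chain:
  assumes R0: "R 0 = E 0"
    and R: "\<And>i j. R (Suc i) j = E (Suc i) j - t i * E i j"
    and t: "\<And>i. Suc i < N \<Longrightarrow> t i \<ge> 0"
    and pos: "\<And>i. Suc i < N \<Longrightarrow> t i = 0 \<or> E i 0 > 0"
    and col: "\<And>i. Suc i < N \<Longrightarrow> R (Suc i) 0 = 0"
    and "0 < M" "0 < N"
  shows "tnn N M E \<longleftrightarrow> tnn N M R"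
proof -
  \<comment> \<open>The intermediate arrays: restored down to row \<open>s\<close>, eliminated below
    it. The lower rows are zero in column \<open>0\<close>, as the elimination requires.\<close>
  define Y where "Y s i = (if i \<le> s then E i else R i)" for s i :: nat
  have step: "tnn N M (Y s) \<longleftrightarrow> tnn N M (Y (Suc s))" if s: "Suc s < N" for s
  proof
    assume "tnn N M (Y s)"
    then have "tnn N M ((Y s)(Suc s := (\<lambda>j. Y s (Suc s) j + t s * Y s s j)))"
      using t[OF s] by (rule tnn_add_previous_row)
    moreover have "(Y s)(Suc s := (\<lambda>j. Y s (Suc s) j + t s * Y s s j)) = Y (Suc s)"
      by (auto simp: Y_def R fun_eq_iff)
    ultimately show "tnn N M (Y (Suc s))" by simp
  next
    assume Y: "tnn N M (Y (Suc s))"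
    show "tnn N M (Y s)"
    proof (cases "t s = 0")
      case True
      then have "Y s = Y (Suc s)" by (auto simp: Y_def R fun_eq_iff le_Suc_eq)
      then show ?thesis using Y by simp
    next
      case False
      then have E: "E s 0 > 0" using pos[OF s] by simp
      have "Y (Suc s) i 0 = 0" if "Suc s < i" "i < N" for i
        using that col[of "i - 1"] by (simp add: Y_def)
      then have "tnn N M ((Y (Suc s))(Suc s := (\<lambda>j. Y (Suc s) (Suc s) j -
          Y (Suc s) (Suc s) 0 / Y (Suc s) s 0 * Y (Suc s) s j)))"
        using E by (intro tnn_eliminate_row[OF Y \<open>0 < M\<close>]) (auto simp: Y_def)
      \<comment> \<open>Since \<open>R (Suc s) 0\<close> vanishes, the elimination multiplier must
        be \<open>t s\<close>.\<close>
      moreover have "E (Suc s) 0 / E s 0 = t s"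
        using col[OF s] R[of s 0] E by simp
      then have "(Y (Suc s))(Suc s := (\<lambda>j. Y (Suc s) (Suc s) j -
          Y (Suc s) (Suc s) 0 / Y (Suc s) s 0 * Y (Suc s) s j)) = Y s"
        by (auto simp: Y_def R fun_eq_iff)
      ultimately show ?thesis by simp
    qed
  qed
  have "tnn N M (Y 0) \<longleftrightarrow> tnn N M (Y s)" if "s < N" for s
    using that
  proof (induction s)
    case (Suc s)
    then show ?case using step[of s] by linarith
  qed simp
  from this[of "N - 1"] have "tnn N M (Y 0) \<longleftrightarrow> tnn N M (Y (N - 1))" using \<open>0 < N\<close> by linarith
  moreover have "Y 0 = R" by (auto simp: Y_def fun_eq_iff R0)
  moreover have "tnn N M (Y (N - 1)) \<longleftrightarrow> tnn N M E"
    by (rule tnn_cong) (auto simp: Y_def)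
  ultimately show ?thesis by simp
qed

section \<open>Newton coefficients by repeated division\<close>

text \<open>For \<open>k < length a\<close> these are divided differences: the value at the first
  node, then the coefficients of the quotient by its linear factor. After all nodes a polynomial of
  degree at most \<open>length a\<close> has left a constant, which the first equation returns for
  every \<open>k\<close>.\<close>

fun newton_coeff :: "real list \<Rightarrow> real poly \<Rightarrow> nat \<Rightarrow> real" where
  "newton_coeff [] p k = coeff p 0"
| "newton_coeff (c # as) p 0 = poly p c"
| "newton_coeff (c # as) p (Suc k) = newton_coeff as (synthetic_div p c) k"

text \<open>Uniqueness of synthetic division makes the quotient linear in the dividend.\<close>

lemma synthetic_div_diff_smult:
  fixes p q :: "real poly"
  shows "synthetic_div (p - smult t q) c = synthetic_div p c - smult t (synthetic_div q c)"
proof -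
  let ?s = "synthetic_div p c - smult t (synthetic_div q c)"
  have "(p - smult t q) + smult c ?s =
      (p + smult c (synthetic_div p c)) - smult t (q + smult c (synthetic_div q c))"
    by (simp add: smult_diff_right smult_add_right mult.commute)
  also have "\<dots> = pCons (poly p c - t * poly q c) ?s"
    by (simp add: synthetic_div_correct)
  finally have "(p - smult t q) + smult c ?s = pCons (poly p c - t * poly q c) ?s" .
  then show ?thesis using synthetic_div_unique by metis
qed

lemma synthetic_div_linear_mult: "synthetic_div ([:-c, 1:] * q) c = q" for q :: "real poly"
proof -
  have "[:-c, 1:] * q + smult c q = pCons 0 q" by simp
  then show ?thesis using synthetic_div_unique by metis
qed

lemma newton_coeff_diff_smult:
  "newton_coeff a (p - smult t q) k = newton_coeff a p k - t * newton_coeff a q k"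
  by (induction a p k arbitrary: q rule: newton_coeff.induct) (simp_all add: synthetic_div_diff_smult)

lemma newton_coeff_0: "newton_coeff a 0 k = 0"
  by (induction a "0 :: real poly" k rule: newton_coeff.induct) simp_all

lemma newton_poly_0 [simp]: "newton_poly a 0 = 1"
  by (simp add: newton_poly_def)

lemma newton_poly_Suc: "newton_poly a (Suc k) = newton_poly a k * [:- (a ! k), 1:]"
  by (simp add: newton_poly_def)

lemma newton_poly_Cons_Suc: "newton_poly (c # as) (Suc k) = [:-c, 1:] * newton_poly as k"
  unfolding newton_poly_def prod.lessThan_Suc_shift by simp

lemma newton_expansion:
  "degree p \<le> length a \<Longrightarrow> p = (\<Sum>k\<le>length a. smult (newton_coeff a p k) (newton_poly a k))"
proof (induction a arbitrary: p)
  case Nil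
  then obtain r where "p = [:r:]" by (auto elim: degree_eq_zeroE)
  then show ?case by simp
next
  case (Cons c as)
  let ?q = "synthetic_div p c"
  have "degree ?q \<le> length as" using Cons.prems by (simp add: degree_synthetic_div)
  then have q: "?q = (\<Sum>k\<le>length as. smult (newton_coeff as ?q k) (newton_poly as k))"
    by (rule Cons.IH)
  have "p = [:poly p c:] + [:-c, 1:] * ?q" by (metis synthetic_div_correct' add.commute)
  also have "[:-c, 1:] * ?q = (\<Sum>k\<le>length as. smult (newton_coeff as ?q k) ([:-c, 1:] * newton_poly as k))"
    by (subst q) (simp only: sum_distrib_left mult_smult_right)
  also have "[:poly p c:] + \<dots> =
      (\<Sum>k\<le>length (c # as). smult (newton_coeff (c # as) p k) (newton_poly (c # as) k))"
    by (simp add: sum.atMost_Suc_shift newton_poly_Cons_Suc del: sum.atMost_Suc mult_pCons_left)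
  finally show ?case .
qed

text \<open>The recursive coefficients satisfy the defining expansion and coordinates are unique, so
  the definite description selects them.\<close>

lemma newton_coords_eq:
  assumes "degree p \<le> length a" "k \<le> length a"
  shows "newton_coords a p $ k = newton_coeff a p k"
proof -
  let ?c = "vec (length a + 1) (newton_coeff a p)"
  have "newton_coords a p = ?c"
    unfolding newton_coords_def
  proof (rule the1_equality[OF newton_coords_ex1[OF assms(1)]], intro conjI)
    have "(\<Sum>k\<le>length a. smult (?c $ k) (newton_poly a k)) =
        (\<Sum>k\<le>length a. smult (newton_coeff a p k) (newton_poly a k))"
      by (rule sum.cong) auto
    then show "p = (\<Sum>k\<le>length a. smult (?c $ k) (newton_poly a k))"
      using newton_expansion[OF assms(1)] by simp
  qed simp
  then show ?thesis using assms(2) by simp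
qed

section \<open>Connection matrices and the rounds of the procedure\<close>

abbreviation connection :: "real list \<Rightarrow> real list \<Rightarrow> nat \<Rightarrow> nat \<Rightarrow> real" where
  "connection e a \<equiv> \<lambda>m. newton_coeff a (newton_poly e m)"

lemma poly_newton_poly: "poly (newton_poly e m) x = (\<Prod>i<m. x - e ! i)"
  by (simp add: newton_poly_def poly_prod)

text \<open>The polynomials of \<open>e\<close> are obtained from \<open>1\<close> and the products of \<open>X - x\<close> with the
  polynomials of \<open>e'\<close> by successively adding multiples \<open>x - e ! i\<close> of the preceding one, as long as
  \<open>i < j\<close>; here \<open>j\<close> is the position of the deleted entry.\<close>

lemma tnn_connection_step:
  assumes len: "length e = Suc (length as)"
    and less: "\<And>i. i < j \<Longrightarrow> i < length e \<Longrightarrow> e ! i < x"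
    and low: "\<And>m. m < j \<Longrightarrow> m < length e \<Longrightarrow> newton_poly e' m = newton_poly e m"
    and high: "\<And>m. j \<le> m \<Longrightarrow> m < length e \<Longrightarrow> newton_poly e (Suc m) = [:-x, 1:] * newton_poly e' m"
  shows "tnn (length as + 2) (length as + 2) (connection e (x # as)) \<longleftrightarrow>
    tnn (length as + 1) (length as + 1) (connection e' as)"
proof -
  let ?N = "length as + 2" and ?E = "connection e (x # as)"
  define t where "t i = (if i < j then x - e ! i else 0)" for i
  define R where "R i j = (case i of 0 \<Rightarrow> ?E 0 j | Suc i' \<Rightarrow> ?E (Suc i') j - t i' * ?E i' j)" for i j
  \<comment> \<open>For \<open>i < j\<close> subtracting \<open>x - e ! i\<close> from the last
    factor \<open>X - e ! i\<close> leaves \<open>X - x\<close>. For \<open>i \<ge> j\<close>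
    nothing is subtracted, because the factor \<open>X - x\<close> is already present.\<close>
  have Rpoly: "newton_poly e (Suc i) - smult (t i) (newton_poly e i) = [:-x, 1:] * newton_poly e' i"
    if i: "i < length e" for i
  proof (cases "i < j")
    case True
    have "newton_poly e (Suc i) - smult (t i) (newton_poly e i) =
        newton_poly e i * ([:- (e ! i), 1:] - [:t i:])"
      by (simp add: newton_poly_Suc algebra_simps smult_diff_left)
    also have "[:- (e ! i), 1:] - [:t i:] = [:-x, 1:]" using True by (simp add: t_def)
    finally show ?thesis using low[OF True i] by (simp only: mult.commute)
  next
    case False
    then show ?thesis using high[of i] i by (simp add: t_def)
  qed
  have R: "R (Suc i) k = newton_coeff (x # as) ([:-x, 1:] * newton_poly e' i) k" if "i < length e" for i k
    unfolding Rpoly[OF that, symmetric] by (simp add: R_def newton_coeff_diff_smult)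
  have "tnn ?N ?N ?E \<longleftrightarrow> tnn ?N ?N R"
  proof (rule tnn_row_chain)
    fix i assume i: "Suc i < ?N"
    show "t i \<ge> 0" using less[of i] i len by (auto simp: t_def intro: less_imp_le)
    \<comment> \<open>Column \<open>0\<close> holds values at \<open>x\<close>. Here the value is a
      product of factors \<open>x - e ! l\<close> with \<open>l < i\<close>, all positive.\<close>
    have "?E i 0 > 0" if "i < j"
      unfolding newton_coeff.simps poly_newton_poly
      by (rule prod_pos) (use less that i len in auto)
    then show "t i = 0 \<or> ?E i 0 > 0" by (auto simp: t_def)
    show "R (Suc i) 0 = 0" using R[of i 0] i len by simp
  qed (auto simp: R_def fun_eq_iff)
  also have "\<dots> \<longleftrightarrow> tnn (length as + 1) (length as + 1) (\<lambda>i k. R (Suc i) (Suc k))"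
  proof -
    have "R 0 k = (if k = 0 then 1 else 0)" for k
      by (cases k) (auto simp: R_def newton_coeff_0 one_pCons)
    moreover have "R (Suc i) 0 = 0" if "i < Suc (length as)" for i
      using R[of i 0] that len by simp
    ultimately show ?thesis
      using tnn_direct_sum_one[of R "Suc (length as)" "Suc (length as)"] by simp
  qed
  also have "\<dots> \<longleftrightarrow> tnn (length as + 1) (length as + 1) (connection e' as)"
    by (rule tnn_cong) (use len in \<open>simp add: R synthetic_div_linear_mult del: mult_pCons_left\<close>)
  finally show ?thesis .
qed

lemma newton_poly_append:
  assumes "m \<le> length ys"
  shows "newton_poly (ys @ zs) m = newton_poly ys m"
  unfolding newton_poly_def by (rule prod.cong) (use assms in \<open>auto simp: nth_append\<close>)

text \<open>Once more than \<open>length ys\<close> factors are taken, the factor of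
  \<open>y\<close> is among them and can be pulled out; the others are the first \<open>m\<close>
  factors of the list without \<open>y\<close>.\<close>

lemma newton_poly_append_Cons:
  assumes "length ys \<le> m"
  shows "newton_poly (ys @ y # zs) (Suc m) = [:-y, 1:] * newton_poly (ys @ zs) m"
  using assms
proof (induction m rule: dec_induct)
  case base
  then show ?case
    by (simp only: newton_poly_Suc[of _ "length ys"] nth_append_length newton_poly_append order_refl mult.commute)
next
  case (step m)
  have "(ys @ y # zs) ! Suc m = (ys @ zs) ! m" using step(1) by (simp add: nth_append Suc_diff_le)
  then show ?case
    by (subst newton_poly_Suc, subst step.IH) (simp only: newton_poly_Suc mult.assoc)
qed

text \<open>Induction on \<open>a\<close> with \<open>e\<close> and the counter \<open>i\<close>
  arbitrary, since a round changes both. The report is compared with its largest possible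
  value.\<close>

lemma tnn_connection_iff:
  "length e = length a \<Longrightarrow>
    tnn (length a + 1) (length a + 1) (connection e a) \<longleftrightarrow> rg_report a i e = i + length a"
proof (induction a arbitrary: e i)
  case Nil
  \<comment> \<open>With a single row available, minors have size at most one, and the only entry is
    \<open>1\<close>.\<close>
  have "minor (connection [] []) k r c \<ge> 0" if "increasing k 1 r" for k r c
  proof -
    have "k < 2"
    proof (rule ccontr)
      assume "\<not> k < 2"
      then have "0 < (1 :: nat)" "1 < k" by auto
      then have "r 0 < r 1" "r 1 < 1" using that unfolding increasing_def by blast+
      then show False by simp
    qed
    then have "k = 0 \<or> k = Suc 0" by auto
    then show ?thesis using that by (auto simp: minor_def increasing_def)
  qed
  then have "tnn 1 1 (connection [] [])" unfolding tnn_def by blast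
  then show ?case using Nil by (simp del: newton_coeff.simps)
next
  case (Cons x as)
  have len: "length e = Suc (length as)" using Cons.prems by simp
  show ?case
  proof (cases "find (\<lambda>y. x \<le> y) e")
    case None
    then have lt: "y < x" if "y \<in> set e" for y using that by (auto simp: find_None_iff)
    \<comment> \<open>All entries lie below \<open>x\<close>, so every row is of the first kind. The
      deleted last entry does not enter products of fewer than \<open>length e\<close>
      factors.\<close>
    have "tnn (length as + 2) (length as + 2) (connection e (x # as)) \<longleftrightarrow>
        tnn (length as + 1) (length as + 1) (connection (butlast e) as)"
    proof (rule tnn_connection_step[OF len])
      fix m assume "m < length e"
      moreover have "e = butlast e @ [last e]" using len by (metis append_butlast_last_id length_0_conv nat.distinct(1))
      ultimately show "newton_poly (butlast e) m = newton_poly e m"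
        using newton_poly_append[of m "butlast e" "[last e]"] by simp
    qed (use lt in auto)
    also have "\<dots> \<longleftrightarrow> rg_report as (Suc i) (butlast e) = Suc i + length as"
      by (rule Cons.IH) (use len in simp)
    finally show ?thesis using None by simp
  next
    case (Some y)
    then obtain j where j: "j < length e" "x \<le> y" "y = e ! j" "\<And>l. l < j \<Longrightarrow> e ! l < x"
      unfolding find_Some_iff by (auto simp: not_le)
    show ?thesis
    proof (cases "y = x")
      case True
      define ys zs where "ys = take j e" and "zs = drop (Suc j) e"
      have e: "e = ys @ x # zs" using id_take_nth_drop[OF j(1)] j(3) True by (simp add: ys_def zs_def)
      have ys: "length ys = j" using j(1) by (simp add: ys_def)
      \<comment> \<open>Entries before position \<open>j\<close> are below \<open>x\<close>, so
        \<open>remove1\<close> deletes the entry at position \<open>j\<close>.\<close>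
      have "x \<notin> set ys" using j(4) ys unfolding e by (metis in_set_conv_nth nth_append less_irrefl)
      then have rem: "remove1 x e = ys @ zs" by (simp add: e remove1_append)
      have "tnn (length as + 2) (length as + 2) (connection e (x # as)) \<longleftrightarrow>
          tnn (length as + 1) (length as + 1) (connection (remove1 x e) as)"
      proof (rule tnn_connection_step[OF len])
        fix m assume "m < j"
        then show "newton_poly (remove1 x e) m = newton_poly e m"
          using ys newton_poly_append[of m ys zs] newton_poly_append[of m ys "x # zs"]
          unfolding rem e[symmetric] by simp
      next
        fix m assume "j \<le> m"
        then show "newton_poly e (Suc m) = [:-x, 1:] * newton_poly (remove1 x e) m"
          using ys newton_poly_append_Cons[of ys m x zs] unfolding rem e[symmetric] by simp
      qed (use j in auto)
      also have "\<dots> \<longleftrightarrow> rg_report as (Suc i) (remove1 x e) = Suc i + length as"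
        by (rule Cons.IH) (use len arg_cong[OF e, of length] in \<open>simp add: rem\<close>)
      finally show ?thesis using Some True by simp
    next
      case False
      \<comment> \<open>The entry in row \<open>Suc j\<close> and column \<open>0\<close> is a value
        at \<open>x\<close>: the factors before position \<open>j\<close> are positive, and
        \<open>x - y\<close> is negative.\<close>
      have "minor (connection e (x # as)) 1 (\<lambda>_. Suc j) (\<lambda>_. 0) = (\<Prod>l<j. x - e ! l) * (x - y)"
        by (simp add: minor_def poly_newton_poly j(3))
      also have "\<dots> < 0"
        by (intro mult_pos_neg prod_pos) (use j False in auto)
      finally have neg: "minor (connection e (x # as)) 1 (\<lambda>_. Suc j) (\<lambda>_. 0) < 0" .
      have "\<not> tnn (length as + 2) (length as + 2) (connection e (x # as))"
      proof
        assume "tnn (length as + 2) (length as + 2) (connection e (x # as))"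
        from tnnD[OF this, of 1 "\<lambda>_. Suc j" "\<lambda>_. 0"] neg show False
          using j(1) len by (simp add: increasing_def)
      qed
      then show ?thesis using Some False by simp
    qed
  qed
qed

section \<open>Index sets and their increasing enumerations\<close>

text \<open>Exactly \<open>i\<close> elements of the image lie below \<open>r i\<close>, and
  \<open>pick\<close> finds an element by that number.\<close>

lemma pick_image_increasing:
  assumes "increasing k N r" "i < k"
  shows "pick (r ` {..<k}) i = r i"
proof -
  have mono: "r a < r b \<longleftrightarrow> a < b" if "a < k" "b < k" for a b
    using assms(1) that unfolding increasing_def by (metis less_asym nat_neq_iff)
  have "{a \<in> r ` {..<k}. a < r i} = r ` {..<i}" using assms(2) mono by auto
  moreover have "inj_on r {..<i}" using mono assms(2) unfolding inj_on_def
    by (metis lessThan_iff less_irrefl nat_neq_iff order_less_trans)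
  ultimately have "card {a \<in> r ` {..<k}. a < r i} = i" by (simp add: card_image)
  then show ?thesis using pick_card_in_set[of "r i" "r ` {..<k}"] assms(2) by simp
qed

lemma increasing_pick:
  assumes "I \<subseteq> {..<N}"
  shows "increasing (card I) N (pick I)"
  unfolding increasing_def
  using assms pick_in_set_le[of _ I] pick_mono_le[of _ I] by auto

text \<open>\<open>pick I\<close> is the increasing enumeration of \<open>I\<close>, and conversely
  an increasing \<open>r\<close> agrees below \<open>k\<close> with \<open>pick\<close> of its
  image, so both notions range over the same minors.\<close>

lemma totally_nonnegative_iff_tnn:
  "totally_nonnegative A \<longleftrightarrow> tnn (dim_row A) (dim_col A) (\<lambda>i j. A $$ (i, j))"
proof -
  have sub: "det (submatrix A I J) = minor (\<lambda>i j. A $$ (i, j)) (card I) (pick I) (pick J)"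
    if "I \<subseteq> {..<dim_row A}" "J \<subseteq> {..<dim_col A}" "card I = card J" for I J
  proof -
    have "{i. i < dim_row A \<and> i \<in> I} = I" "{i. i < dim_col A \<and> i \<in> J} = J" using that by auto
    then show ?thesis using that(3) by (simp add: submatrix_def minor_def fdet_def)
  qed
  show ?thesis
  proof
    assume A: "totally_nonnegative A"
    show "tnn (dim_row A) (dim_col A) (\<lambda>i j. A $$ (i, j))"
      unfolding tnn_def
    proof (intro allI impI)
      fix k r c assume r: "increasing k (dim_row A) r" and c: "increasing k (dim_col A) c"
      have card: "card (f ` {..<k}) = k" if "increasing k N f" for f N
        using that unfolding increasing_def
        by (subst card_image) (auto simp: inj_on_def, metis less_irrefl nat_neq_iff)
      have "det (submatrix A (r ` {..<k}) (c ` {..<k})) =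
          minor (\<lambda>i j. A $$ (i, j)) k (pick (r ` {..<k})) (pick (c ` {..<k}))"
        using r c by (subst sub) (auto simp: card[OF r] card[OF c] increasing_def)
      also have "\<dots> = minor (\<lambda>i j. A $$ (i, j)) k r c"
        unfolding minor_def
        by (rule fdet_cong) (simp add: pick_image_increasing[OF r] pick_image_increasing[OF c])
      finally show "minor (\<lambda>i j. A $$ (i, j)) k r c \<ge> 0"
        using A r c card[OF r] card[OF c] unfolding totally_nonnegative_def
        by (metis increasing_def image_subset_iff lessThan_iff)
    qed
  next
    assume "tnn (dim_row A) (dim_col A) (\<lambda>i j. A $$ (i, j))"
    then show "totally_nonnegative A"
      unfolding totally_nonnegative_def using sub increasing_pick tnnD by metis
  qed
qed

theorem theorem1p8:
  fixes a e :: "real list" and n :: nat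
  assumes "length a = n" and "length e = n"
  shows "totally_nonnegative (change_of_basis_matrix e a) \<longleftrightarrow> restricted_growth a e"
proof -
  have "totally_nonnegative (change_of_basis_matrix e a) \<longleftrightarrow>
      tnn (length a + 1) (length a + 1) (\<lambda>i j. change_of_basis_matrix e a $$ (i, j))"
    unfolding totally_nonnegative_iff_tnn using assms by (simp add: change_of_basis_matrix_def)
  also have "\<dots> \<longleftrightarrow> tnn (length a + 1) (length a + 1) (connection e a)"
    by (rule tnn_cong)
      (use assms in \<open>simp add: change_of_basis_matrix_def newton_coords_eq degree_newton_poly\<close>)
  also have "\<dots> \<longleftrightarrow> restricted_growth a e"
    using tnn_connection_iff[of e a 1] assms by (simp add: restricted_growth_def)
  finally show ?thesis .
qed

end
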